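(* Let $X$ be a compact metric space with metric $d$, let $f:X\to X$ be continuous, and suppose $d$ is adapted to $f$ with constants $\lambda>1$ and $\varepsilon>0$, i.e. for all $x,y\in X$, $$d(x,y)<\varepsilon\implies d(f(x),f(y))\ge\lambda\, d(x,y).$$ Let $\mathcal{M}$ be a Markov partition for $f$. Then $$\dim_H(\partial\mathcal{M})\le\frac{h(f|_{\partial\mathcal{M}})}{\log\lambda}.$$
   Context: A set $R\subset X$ is proper if $R=\overline{\operatorname{int}(R)}\neq\emptyset$. A Markov partition for $(X,f)$ (a system as in the claim is positively expansive with expansive constant determined by $\varepsilon$) is a finite cover $\mathcal{M}=\{R_i\}_{i=1}^n$ of $X$ by proper sets with pairwise disjoint interiors such that: (1) (metrically generating) for all $(x_k)_{k\ge 0}\in\{1,\dots,n\}^{\mathbb{N}}$, the set $\bigcap_{k=0}^\infty f^{-k}(\operatorname{int}(R_{x_k}))$ consists of at most one point; (2) (Markov property) for all $R,R'\in\mathcal{M}$, if $f(\operatorname{int}(R))\cap\operatorname{int}(R')\neq\emptyset$, then each $y\in\operatorname{int}(R')$ has a unique preimage under $f$ in $R$. The boundary of $\mathcal{M}$ is $\partial\mathcal{M}:=\bigcup_{R\in\mathcal{M}}\partial R$; it is a compact set with $f(\partial\mathcal{M})\subset\partial\mathcal{M}$. $\dim_H$ denotes Hausdorff dimension with respect to the adapted metric $d$, and $h(\cdot)$ denotes topological entropy (with the convention that both are $0$ for the empty set). *)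

theory Defs
  imports "HOL-Analysis.Analysis"
begin

subsection \<open>Markov partitions\<close>

text \<open>The phase space is the whole type; \<open>interior\<close>, \<open>closure\<close> and \<open>frontier\<close> are taken in it.\<close>

definition proper_set :: "'a::topological_space set \<Rightarrow> bool" where
  "proper_set R \<longleftrightarrow> R = closure (interior R) \<and> R \<noteq> {}"

text \<open>The partition \<open>{R\<^sub>1, \<dots>, R\<^sub>n}\<close> is the set \<open>\<M>\<close> of its members, and an index
  sequence in \<open>{1, \<dots>, n}\<close> is a sequence of members. Nothing is lost compared with an indexed
  family, as proper sets with pairwise disjoint interiors are pairwise distinct.\<close>

definition metrically_generating ::
    "('a::topological_space \<Rightarrow> 'a) \<Rightarrow> 'a set set \<Rightarrow> bool" where
  "metrically_generating f \<M> \<longleftrightarrow>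
     (\<forall>x :: nat \<Rightarrow> 'a set. (\<forall>k. x k \<in> \<M>) \<longrightarrow>
        (\<forall>p \<in> (\<Inter>k. (f ^^ k) -` interior (x k)).
         \<forall>q \<in> (\<Inter>k. (f ^^ k) -` interior (x k)). p = q))"

definition markov_property ::
    "('a::topological_space \<Rightarrow> 'a) \<Rightarrow> 'a set set \<Rightarrow> bool" where
  "markov_property f \<M> \<longleftrightarrow>
     (\<forall>R\<in>\<M>. \<forall>R'\<in>\<M>. f ` interior R \<inter> interior R' \<noteq> {} \<longrightarrow>
        (\<forall>y\<in>interior R'. \<exists>!x. x \<in> R \<and> f x = y))"

definition markov_partition ::
    "('a::topological_space \<Rightarrow> 'a) \<Rightarrow> 'a set set \<Rightarrow> bool" where
  "markov_partition f \<M> \<longleftrightarrow>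
     finite \<M> \<and> \<Union>\<M> = UNIV \<and> (\<forall>R\<in>\<M>. proper_set R) \<and>
     (\<forall>R\<in>\<M>. \<forall>R'\<in>\<M>. R \<noteq> R' \<longrightarrow> interior R \<inter> interior R' = {}) \<and>
     metrically_generating f \<M> \<and> markov_property f \<M>"

definition partition_boundary :: "'a::topological_space set set \<Rightarrow> 'a set" where
  "partition_boundary \<M> = (\<Union>R\<in>\<M>. frontier R)"

subsection \<open>Adapted metrics\<close>

definition adapted_metric :: "('a::metric_space \<Rightarrow> 'a) \<Rightarrow> real \<Rightarrow> real \<Rightarrow> bool" where
  "adapted_metric f lam \<epsilon> \<longleftrightarrow> 1 < lam \<and> 0 < \<epsilon> \<and>
     (\<forall>x y. dist x y < \<epsilon> \<longrightarrow> dist (f x) (f y) \<ge> lam * dist x y)"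

subsection \<open>Hausdorff dimension\<close>

text \<open>The summand \<open>diam(U)\<^sup>s\<close>, with the usual conventions \<open>0\<^sup>0 = 1\<close> and value \<open>0\<close> for the empty
  set; they are spelled out because \<open>0 powr 0 = 0\<close> in the library.\<close>

definition diam_power :: "real \<Rightarrow> 'a::metric_space set \<Rightarrow> ennreal" where
  "diam_power s U =
     (if U = {} then 0 else if s = 0 then 1 else ennreal (diameter U powr s))"

text \<open>Boundedness is required of the covering sets because \<open>diameter\<close> is real-valued and only
  meaningful for bounded sets.\<close>

definition hausdorff_content :: "real \<Rightarrow> real \<Rightarrow> 'a::metric_space set \<Rightarrow> ennreal" where
  "hausdorff_content \<delta> s A =
     (INF U \<in> {U :: nat \<Rightarrow> 'a set. A \<subseteq> (\<Union>i. U i) \<and> (\<forall>i. bounded (U i) \<and> diameter (U i) \<le> \<delta>)}.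
        \<Sum>i. diam_power s (U i))"

text \<open>The content is nonincreasing in \<open>\<delta>\<close>, so the supremum is the limit as \<open>\<delta>\<close> tends to \<open>0\<close>.\<close>

definition hausdorff_measure :: "real \<Rightarrow> 'a::metric_space set \<Rightarrow> ennreal" where
  "hausdorff_measure s A = (SUP \<delta> \<in> {0<..}. hausdorff_content \<delta> s A)"

definition hausdorff_dim :: "'a::metric_space set \<Rightarrow> ereal" where
  "hausdorff_dim A = (INF s \<in> {s. 0 \<le> s \<and> hausdorff_measure s A = 0}. ereal s)"

lemma hausdorff_dim_empty: "hausdorff_dim ({} :: 'a::metric_space set) = 0"
proof -
  have "hausdorff_content \<delta> 0 ({} :: 'a set) = 0" if "\<delta> > 0" for \<delta>
  proof -
    have "hausdorff_content \<delta> 0 ({} :: 'a set) \<le> (\<Sum>i::nat. diam_power 0 ({} :: 'a set))"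
      unfolding hausdorff_content_def using that by (intro INF_lower) auto
    also have "\<dots> = 0" by (simp add: diam_power_def)
    finally show ?thesis by simp
  qed
  then have "hausdorff_measure 0 ({} :: 'a set) = 0"
    by (simp add: hausdorff_measure_def)
  then have "hausdorff_dim ({} :: 'a set) \<le> ereal 0"
    unfolding hausdorff_dim_def by (intro INF_lower) auto
  moreover have "0 \<le> hausdorff_dim ({} :: 'a set)"
    unfolding hausdorff_dim_def by (intro INF_greatest) auto
  ultimately show ?thesis by (simp add: zero_ereal_def)
qed

subsection \<open>Topological entropy\<close>

text \<open>Bowen's definition for the system \<open>f|\<^sub>K\<close>, where \<open>K\<close> is meant to be compact with
  \<open>f ` K \<subseteq> K\<close>: then all points and orbits involved lie in \<open>K\<close>.\<close>

definition spanning_set ::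
    "('a::metric_space \<Rightarrow> 'a) \<Rightarrow> 'a set \<Rightarrow> nat \<Rightarrow> real \<Rightarrow> 'a set \<Rightarrow> bool" where
  "spanning_set f K n e E \<longleftrightarrow> finite E \<and> E \<subseteq> K \<and>
     (\<forall>x\<in>K. \<exists>y\<in>E. \<forall>k<n. dist ((f ^^ k) x) ((f ^^ k) y) \<le> e)"

text \<open>The logarithm of the least cardinality of an \<open>(n, e)\<close>-spanning set (\<open>\<infinity>\<close> if none is finite).\<close>

definition log_spanning_number ::
    "('a::metric_space \<Rightarrow> 'a) \<Rightarrow> 'a set \<Rightarrow> nat \<Rightarrow> real \<Rightarrow> ereal" where
  "log_spanning_number f K n e = (INF E \<in> {E. spanning_set f K n e E}. ereal (ln (real (card E))))"

text \<open>The growth rate is nonincreasing in \<open>e\<close>, so the supremum is the limit as \<open>e\<close> tends to \<open>0\<close>.\<close>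

definition topological_entropy :: "('a::metric_space \<Rightarrow> 'a) \<Rightarrow> 'a set \<Rightarrow> ereal" where
  "topological_entropy f K =
     (if K = {} then 0
      else (SUP e \<in> {0<..}. limsup (\<lambda>n. log_spanning_number f K n e / ereal (real n))))"

end

theory Submission
  imports Defs
begin

text \<open>
  The boundary of the partition is treated as an instance of an arbitrary set \<open>K\<close>: small Bowen balls
  are automatically good covering sets for the Hausdorff measure. Write \<open>\<lambda>\<close> for the expansion
  constant and \<open>h\<close> for the entropy of \<open>K\<close>. Let \<open>E\<close> be \<open>(n, e)\<close>-spanning for \<open>K\<close> with
  \<open>2 e < \<epsilon>\<close>. Two points of \<open>K\<close> that are shadowed by the same point of \<open>E\<close> for \<open>n\<close> steps have
  orbits staying \<open>\<epsilon>\<close>-close during that time, and since each step expands such distances by the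
  factor \<open>\<lambda>\<close>, the points were at distance at most \<open>\<epsilon> / \<lambda>\<^sup>n\<^sup>-\<^sup>1\<close> initially
  (\<open>spanning_set_content_le\<close>). So the Bowen balls around \<open>E\<close> cover \<open>K\<close> by \<open>card E\<close> sets
  of that diameter. When \<open>E\<close> is chosen economically, \<open>card E\<close> grows at most like \<open>exp (n t)\<close>
  for any \<open>t\<close> above the entropy, so the \<open>s\<close>-dimensional sum of this cover is of order
  \<open>exp (n (t - s log \<lambda>))\<close>, which vanishes in the limit as soon as \<open>s log \<lambda> > t\<close>
  (\<open>hausdorff_measure_eq_0_if_entropy_less\<close>). Letting \<open>s\<close> decrease to \<open>h / log \<lambda>\<close> gives the bound.
\<close>

text \<open>As long as the two orbits are \<open>\<epsilon>\<close>-close, the one-step expansion can be iterated.\<close>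

lemma adapted_metric_iterate:
  assumes "adapted_metric f lam \<epsilon>"
    and "\<And>k. k < n \<Longrightarrow> dist ((f ^^ k) x) ((f ^^ k) y) < \<epsilon>"
  shows "lam ^ n * dist x y \<le> dist ((f ^^ n) x) ((f ^^ n) y)"
  using assms(2)
proof (induction n)
  case 0
  then show ?case by simp
next
  case (Suc n)
  have "lam ^ Suc n * dist x y \<le> lam * dist ((f ^^ n) x) ((f ^^ n) y)"
    using Suc assms(1) by (simp add: adapted_metric_def mult.assoc)
  also have "\<dots> \<le> dist (f ((f ^^ n) x)) (f ((f ^^ n) y))"
    using Suc.prems assms(1) by (simp add: adapted_metric_def)
  finally show ?case by simp
qed

lemma hausdorff_content_le_finite_cover:
  assumes "finite E" "K \<subseteq> (\<Union>y\<in>E. B y)" "0 \<le> \<delta>"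
    and "\<And>y. y \<in> E \<Longrightarrow> bounded (B y) \<and> diameter (B y) \<le> \<delta>"
  shows "hausdorff_content \<delta> s K \<le> (\<Sum>y\<in>E. diam_power s (B y))"
proof -
  obtain g where g: "bij_betw g {..<card E} E"
    using \<open>finite E\<close> bij_betw_from_nat_into_finite by blast
  define U where "U i = (if i < card E then B (g i) else {})" for i
  have "K \<subseteq> (\<Union>i. U i)"
  proof
    fix x assume "x \<in> K"
    then obtain y where "y \<in> E" "x \<in> B y" using assms(2) by blast
    moreover then obtain i where "i < card E" "g i = y"
      using g unfolding bij_betw_def by (metis imageE lessThan_iff)
    ultimately show "x \<in> (\<Union>i. U i)" by (auto simp: U_def intro!: exI[of _ i])
  qed
  moreover have "bounded (U i) \<and> diameter (U i) \<le> \<delta>" for i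
    using assms(3,4) g by (auto simp: U_def bij_betw_def)
  ultimately have "hausdorff_content \<delta> s K \<le> (\<Sum>i. diam_power s (U i))"
    unfolding hausdorff_content_def by (intro INF_lower) auto
  also have "\<dots> = (\<Sum>i<card E. diam_power s (U i))"
    by (rule suminf_finite) (auto simp: U_def diam_power_def)
  also have "\<dots> = (\<Sum>i<card E. diam_power s (B (g i)))"
    by (simp add: U_def)
  also have "\<dots> = (\<Sum>y\<in>E. diam_power s (B y))"
    by (rule sum.reindex_bij_betw[OF g])
  finally show ?thesis .
qed

text \<open>The geometric core: expansion makes Bowen balls of length \<open>Suc m\<close> exponentially small in
  \<open>m\<close>. Only \<open>m\<close> factors are gained because \<open>Suc m\<close> orbit points are compared, the last one serving
  to bound the distance from above. The radius \<open>\<epsilon> / 4\<close> leaves room for the triangle inequality and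
  keeps the resulting distances strictly below \<open>\<epsilon>\<close>.\<close>

lemma spanning_set_content_le:
  assumes ad: "adapted_metric f lam \<epsilon>"
    and sp: "spanning_set f K (Suc m) (\<epsilon> / 4) E"
    and s: "0 < s" and small: "\<epsilon> / lam ^ m \<le> \<delta>"
  shows "hausdorff_content \<delta> s K \<le> ennreal (real (card E) * (\<epsilon> / lam ^ m) powr s)"
proof -
  have lam: "1 < lam" and eps: "0 < \<epsilon>" using ad by (auto simp: adapted_metric_def)
  have D0: "0 \<le> \<epsilon> / lam ^ m" using lam eps by simp
  define B where
    "B y = {x \<in> K. \<forall>k<Suc m. dist ((f ^^ k) x) ((f ^^ k) y) \<le> \<epsilon> / 4}" for y
  have close: "dist x x' \<le> \<epsilon> / lam ^ m" if "x \<in> B y" "x' \<in> B y" for x x' y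
  proof -
    have orb: "dist ((f ^^ k) x) ((f ^^ k) x') < \<epsilon>" if "k < Suc m" for k
    proof -
      have "dist ((f ^^ k) x) ((f ^^ k) x')
          \<le> dist ((f ^^ k) x) ((f ^^ k) y) + dist ((f ^^ k) x') ((f ^^ k) y)"
        by (rule dist_triangle2)
      also have "\<dots> \<le> \<epsilon> / 4 + \<epsilon> / 4"
        using \<open>x \<in> B y\<close> \<open>x' \<in> B y\<close> that by (intro add_mono) (auto simp: B_def)
      finally show ?thesis using eps by simp
    qed
    have "lam ^ m * dist x x' \<le> dist ((f ^^ m) x) ((f ^^ m) x')"
      using adapted_metric_iterate[OF ad] orb by simp
    also have "\<dots> \<le> \<epsilon>" using orb[of m] by simp
    finally show ?thesis using lam by (simp add: field_simps)
  qed
  have diam: "diameter (B y) \<le> \<epsilon> / lam ^ m" for y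
    using D0 close by (auto simp: diameter_def intro!: cSUP_least)
  have bdd: "bounded (B y)" for y
    using close unfolding bounded_two_points by blast
  have "hausdorff_content \<delta> s K \<le> (\<Sum>y\<in>E. diam_power s (B y))"
  proof (rule hausdorff_content_le_finite_cover)
    show "finite E" using sp by (simp add: spanning_set_def)
    show "K \<subseteq> (\<Union>y\<in>E. B y)" using sp by (fastforce simp: spanning_set_def B_def)
    show "0 \<le> \<delta>" using D0 small by simp
    show "bounded (B y) \<and> diameter (B y) \<le> \<delta>" for y
      using bdd diam[of y] small by simp
  qed
  also have "\<dots> \<le> (\<Sum>y\<in>E. ennreal ((\<epsilon> / lam ^ m) powr s))"
    using s diam bdd diameter_ge_0
    by (intro sum_mono) (auto simp: diam_power_def intro!: ennreal_leI powr_mono2)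
  also have "\<dots> = ennreal (real (card E) * (\<epsilon> / lam ^ m) powr s)"
    by (simp add: ennreal_mult ennreal_of_nat_eq_real_of_nat)
  finally show ?thesis .
qed

text \<open>Since some term of the infimum in \<open>log_spanning_number\<close> is below \<open>n t\<close> for all large \<open>n\<close>, a
  bound on the entropy yields actual spanning sets of exponentially bounded size.\<close>

lemma eventually_small_spanning_set:
  assumes "topological_entropy f K < ereal t" "K \<noteq> {}" "0 < e"
  shows "\<forall>\<^sub>F n in sequentially. \<exists>E. spanning_set f K n e E \<and> real (card E) \<le> exp (real n * t)"
proof -
  have "limsup (\<lambda>n. log_spanning_number f K n e / ereal (real n)) \<le> topological_entropy f K"
    using assms(2,3) by (auto simp: topological_entropy_def intro: SUP_upper)
  then have "limsup (\<lambda>n. log_spanning_number f K n e / ereal (real n)) < ereal t"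
    using assms(1) by (rule le_less_trans)
  then have "\<forall>\<^sub>F n in sequentially. log_spanning_number f K n e / ereal (real n) < ereal t"
    by (rule Limsup_lessD)
  then show ?thesis
    using eventually_gt_at_top[of 0]
  proof eventually_elim
    case (elim n)
    then have "log_spanning_number f K n e < ereal (real n * t)"
      by (simp add: ereal_divide_less_iff mult.commute)
    then obtain E where E: "spanning_set f K n e E" "ln (real (card E)) < real n * t"
      unfolding log_spanning_number_def INF_less_iff by auto
    have "E \<noteq> {}" using E(1) \<open>K \<noteq> {}\<close> by (auto simp: spanning_set_def)
    then have "0 < real (card E)" using E(1) by (auto simp: spanning_set_def card_gt_0_iff)
    then have "real (card E) = exp (ln (real (card E)))" by simp
    also have "\<dots> \<le> exp (real n * t)" using E(2) by simp
    finally show ?case using E(1) by blast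
  qed
qed

lemma topological_entropy_nonneg: "0 \<le> topological_entropy f K"
proof (cases "K = {}")
  case True
  then show ?thesis by (simp add: topological_entropy_def)
next
  case False
  have "0 \<le> log_spanning_number f K n 1 / ereal (real n)" for n
  proof -
    have "0 \<le> ereal (ln (real (card E)))" if "spanning_set f K n 1 E" for E
    proof -
      have "E \<noteq> {}" "finite E" using that False by (auto simp: spanning_set_def)
      then have "1 \<le> card E" by (simp add: Suc_le_eq card_gt_0_iff)
      then show ?thesis by simp
    qed
    then have "0 \<le> log_spanning_number f K n 1"
      unfolding log_spanning_number_def by (intro INF_greatest) auto
    then show ?thesis by (cases "n = 0") (auto simp: ereal_divide_eq ereal_le_divide_pos)
  qed
  then have "0 \<le> limsup (\<lambda>n. log_spanning_number f K n 1 / ereal (real n))"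
    by (intro le_Limsup) auto
  also have "\<dots> \<le> topological_entropy f K"
    using False by (auto simp: topological_entropy_def intro: SUP_upper)
  finally show ?thesis .
qed

text \<open>At scale \<open>m\<close> the \<open>s\<close>-dimensional sum is at most a constant times \<open>q ^ m\<close>, where
  \<open>q = exp (t - s log \<lambda>)\<close> measures the competition between the number of Bowen balls and the decay
  of their diameters.\<close>

lemma hausdorff_measure_eq_0_if_entropy_less:
  assumes ad: "adapted_metric f lam \<epsilon>" and "K \<noteq> {}"
    and ent: "topological_entropy f K < ereal (s * ln lam)" and s: "0 < s"
  shows "hausdorff_measure s K = 0"
proof -
  have lam: "1 < lam" and eps: "0 < \<epsilon>" using ad by (auto simp: adapted_metric_def)
  obtain t where t: "topological_entropy f K < ereal t" "t < s * ln lam"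
    using ereal_dense2[OF ent] by auto
  define q where "q = exp (t - s * ln lam)"
  define b where "b m = (exp t * \<epsilon> powr s) * q ^ m" for m
  have q: "0 \<le> q" "q < 1" using t(2) by (auto simp: q_def)
  have b0: "b \<longlonglongrightarrow> 0"
    unfolding b_def using q by (intro tendsto_mult_right_zero LIMSEQ_realpow_zero)
  have b_eq: "exp (real (Suc m) * t) * (\<epsilon> / lam ^ m) powr s = b m" for m
  proof -
    have "(lam ^ m) powr s = exp (real m * (s * ln lam))"
      using lam by (simp add: powr_def ln_realpow mult_ac)
    moreover have "q ^ m = exp (real m * (t - s * ln lam))"
      by (simp add: q_def exp_of_nat_mult)
    ultimately show ?thesis
      using lam eps
      by (simp add: b_def powr_divide exp_diff right_diff_distrib distrib_right exp_add)
  qed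
  have "hausdorff_content \<delta> s K = 0" if "0 < \<delta>" for \<delta>
  proof -
    have "(\<lambda>m. \<epsilon> / lam ^ m) \<longlonglongrightarrow> 0"
      using lam by (intro LIMSEQ_divide_realpow_zero)
    then have small: "\<forall>\<^sub>F m in sequentially. \<epsilon> / lam ^ m < \<delta>"
      using \<open>0 < \<delta>\<close> by (rule order_tendstoD)
    have spanning: "\<forall>\<^sub>F m in sequentially.
        \<exists>E. spanning_set f K (Suc m) (\<epsilon> / 4) E \<and> real (card E) \<le> exp (real (Suc m) * t)"
      using eventually_small_spanning_set[OF t(1) \<open>K \<noteq> {}\<close>, of "\<epsilon> / 4"] eps
      by (subst eventually_sequentially_Suc) simp
    have "\<forall>\<^sub>F m in sequentially. hausdorff_content \<delta> s K \<le> ennreal (b m)"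
      using small spanning
    proof eventually_elim
      case (elim m)
      then obtain E where E: "spanning_set f K (Suc m) (\<epsilon> / 4) E"
        "real (card E) \<le> exp (real (Suc m) * t)" by blast
      have "hausdorff_content \<delta> s K \<le> ennreal (real (card E) * (\<epsilon> / lam ^ m) powr s)"
        using elim(1) by (intro spanning_set_content_le[OF ad E(1) s]) simp
      also have "\<dots> \<le> ennreal (b m)"
        unfolding b_eq[symmetric] using E(2) by (intro ennreal_leI mult_right_mono) auto
      finally show ?case .
    qed
    moreover have "(\<lambda>m. ennreal (b m)) \<longlonglongrightarrow> 0"
      using tendsto_ennrealI[OF b0] by simp
    ultimately have "hausdorff_content \<delta> s K \<le> 0"
      by (intro tendsto_lowerbound) auto
    then show ?thesis by simp
  qed
  then show ?thesis by (simp add: hausdorff_measure_def)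
qed

theorem hausdorff_dim_le_entropy:
  assumes ad: "adapted_metric f lam \<epsilon>"
  shows "hausdorff_dim K \<le> topological_entropy f K / ereal (ln lam)"
proof (cases "K = {}")
  case True
  then show ?thesis by (simp add: hausdorff_dim_empty topological_entropy_def)
next
  case False
  have ln: "0 < ln lam" using ad by (simp add: adapted_metric_def)
  show ?thesis
  proof (rule dense_ge)
    fix x assume x: "topological_entropy f K / ereal (ln lam) < x"
    show "hausdorff_dim K \<le> x"
    proof (cases x)
      case (real s)
      have ent: "topological_entropy f K < ereal (s * ln lam)"
        using x ln by (simp add: real ereal_divide_less_iff mult.commute)
      then have "0 < s * ln lam"
        using topological_entropy_nonneg[of f K] by (metis le_less_trans ereal_less(2))
      then have "0 < s" using ln by (simp add: zero_less_mult_iff)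
      then have "hausdorff_measure s K = 0"
        using hausdorff_measure_eq_0_if_entropy_less[OF ad False ent] by simp
      then show ?thesis
        using \<open>0 < s\<close> by (auto simp: hausdorff_dim_def real intro: INF_lower)
    qed (use x in auto)
  qed
qed

theorem theorem5p1:
  fixes f :: "'a::metric_space \<Rightarrow> 'a" and lam \<epsilon> :: real and \<M> :: "'a set set"
  assumes "compact (UNIV :: 'a set)"
    and "continuous_on UNIV f"
    and "adapted_metric f lam \<epsilon>"
    and "markov_partition f \<M>"
  shows "hausdorff_dim (partition_boundary \<M>)
           \<le> topological_entropy f (partition_boundary \<M>) / ereal (ln lam)"
  using assms(3) by (rule hausdorff_dim_le_entropy)

end
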